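(* Let $\ell=20$, $m=2\ell+1$ and $\lambda=(1^{\ell},0^{\ell+1})$, i.e. $\lambda$ consists of $\ell$ ones followed by $\ell+1$ zeros. Let $F$ be the set of points $(x^i_j)_{1\le j\le i\le m}$ of the Gelfand--Tsetlin polytope $\mathcal{G}_\lambda$ such that all entries with $2j\le i$ are equal to each other, all entries with $j\ge \ell+1$ are equal to each other, and all entries with $2j\ge i+2$ and $j\le \ell$ are equal to each other. Then $F$ is a face of $\mathcal{G}_\lambda$ and its Ehrhart polynomial has a negative coefficient.
   Context: For a partition $\lambda=(\lambda_1\ge\dots\ge\lambda_m\ge0)$, the Gelfand--Tsetlin polytope $\mathcal{G}_\lambda$ is the set of triangular arrays of non-negative real numbers $(x^i_j)_{1\le j\le i\le m}$ with top row $x^m_j=\lambda_j$ for $1\le j\le m$ and satisfying $$x^{i+1}_j\ge x^i_j\quad\text{and}\quad x^i_j\ge x^{i+1}_{j+1}\qquad (1\le j\le i\le m-1).$$ Faces of $\mathcal{G}_\lambda$ are obtained by forcing some of these inequalities to be equalities. For a polytope $\mathcal{P}\subset\mathbb{R}^N$ with integer vertices, its Ehrhart polynomial is the polynomial $\mathrm{ehr}_{\mathcal{P}}$ with $\mathrm{ehr}_{\mathcal{P}}(n)=\#(n\mathcal{P}\cap\mathbb{Z}^N)$ for all positive integers $n$. (All polytopes $\mathcal G_\lambda$ and their faces, for $\lambda$ a partition, have integer vertices.) *)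

theory Defs
  imports
    "HOL-Analysis.Analysis"
    "HOL-Analysis.Finite_Function_Topology"
    "HOL-Computational_Algebra.Polynomial"
begin

definition gt_indices :: "nat \<Rightarrow> (nat \<times> nat) set" where
  "gt_indices m = {(i, j). 1 \<le> j \<and> j \<le> i \<and> i \<le> m}"

text \<open>
  The pair (i, j) stands for the entry in row i and column j, both counted from 1, whereas
  list positions are counted from 0. Triangular arrays are finitely supported functions that
  vanish off the triangle, so that arrays of every size live in one real vector space and
  the library notion of a face of a convex set applies.
\<close>

definition gt_polytope :: "nat list \<Rightarrow> ((nat \<times> nat) \<Rightarrow>\<^sub>0 real) set" where
  "gt_polytope lam =
    {x. Poly_Mapping.keys x \<subseteq> gt_indices (length lam) \<and>
        (\<forall>i j. 0 \<le> Poly_Mapping.lookup x (i, j)) \<and>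
        (\<forall>j \<in> {1..length lam}.
            Poly_Mapping.lookup x (length lam, j) = real (lam ! (j - 1))) \<and>
        (\<forall>i j. 1 \<le> j \<and> j \<le> i \<and> i + 1 \<le> length lam \<longrightarrow>
            Poly_Mapping.lookup x (i + 1, j) \<ge> Poly_Mapping.lookup x (i, j) \<and>
            Poly_Mapping.lookup x (i, j) \<ge> Poly_Mapping.lookup x (i + 1, j + 1))}"

definition integer_points :: "('a \<Rightarrow>\<^sub>0 real) set" where
  "integer_points = {x. \<forall>k. Poly_Mapping.lookup x k \<in> \<int>}"

definition is_ehrhart_polynomial :: "('a \<Rightarrow>\<^sub>0 real) set \<Rightarrow> real poly \<Rightarrow> bool" where
  "is_ehrhart_polynomial P p \<longleftrightarrow>
    (\<forall>n::nat. 0 < n \<longrightarrow>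
      poly p (real n) = real (card ((\<lambda>x. real n *\<^sub>R x) ` P \<inter> integer_points)))"

lemma is_ehrhart_polynomial_unique:
  assumes "is_ehrhart_polynomial P p" and "is_ehrhart_polynomial P q"
  shows "p = q"
proof (rule ccontr)
  assume "p \<noteq> q"
  then have "finite {x. poly (p - q) x = 0}"
    by (intro poly_roots_finite) simp
  moreover have "real ` {0<..} \<subseteq> {x. poly (p - q) x = 0}"
    using assms by (auto simp: is_ehrhart_polynomial_def)
  moreover have "infinite (real ` {0<..})"
    by (simp add: finite_image_iff infinite_Ioi)
  ultimately show False
    using finite_subset by blast
qed

end

theory Submission
  imports Defs
begin

text \<open>
  On the face, the entries with $2j \<le> i$ are 1 and those with $j > l$ are 0, both forced by the
  top row; the entries with $2j \<ge> i + 2$ and $j \<le> l$ share a value $t$, and the only other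
  entries are the $l$ independent ones $y_j$ at $(2j - 1, j)$, subject to $0 \<le> t \<le> y_j \<le> 1$.
  Hence the $n$-th dilate has $1^l + 2^l + \<dots> + (n + 1)^l$ integer points. For $l = 20$, the linear
  coefficient of this polynomial in $n$ is $B_{20} + 20 < 0$, with $B_{20}$ the Bernoulli number.
\<close>

section \<open>Finitely supported arrays and faces given by equal entries\<close>

lemma lookup_scaleR [simp]:
  fixes x :: "'a \<Rightarrow>\<^sub>0 'b::real_vector"
  shows "Poly_Mapping.lookup (r *\<^sub>R x) k = r *\<^sub>R Poly_Mapping.lookup x k"
proof -
  \<comment> \<open>Scaling is built with \<open>Abs_poly_mapping\<close>, which returns the given
    function only if its support is finite.\<close>
  have "{k. r *\<^sub>R Poly_Mapping.lookup x k \<noteq> 0} \<subseteq> Poly_Mapping.keys x"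
    by (auto simp: in_keys_iff)
  then have "finite {k. r *\<^sub>R Poly_Mapping.lookup x k \<noteq> 0}"
    using finite_keys finite_subset by blast
  then show ?thesis
    by (simp add: scaleR_poly_mapping_def)
qed

text \<open>Each pair in \<open>E\<close> has a slack, the difference of its two entries, which is
  nonnegative on \<open>S\<close>. At a point strictly between \<open>a\<close> and \<open>b\<close>
  the slack is a combination, with positive weights, of the slacks at \<open>a\<close> and
  \<open>b\<close>, so it vanishes only if both of these do.\<close>

lemma face_of_lookup_equalities:
  fixes S :: "('a \<Rightarrow>\<^sub>0 real) set"
  assumes "convex S"
    and le: "\<And>y p q. y \<in> S \<Longrightarrow> (p, q) \<in> E \<Longrightarrow> Poly_Mapping.lookup y p \<le> Poly_Mapping.lookup y q"
  shows "{y \<in> S. \<forall>(p, q) \<in> E. Poly_Mapping.lookup y p = Poly_Mapping.lookup y q} face_of S"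
    (is "?F face_of S")
proof -
  have conv: "convex ?F"
    unfolding convex_def
    using convexD[OF \<open>convex S\<close>] by (auto simp: lookup_add split_beta)
  moreover have "a \<in> ?F \<and> b \<in> ?F"
    if "a \<in> S" "b \<in> S" "x \<in> ?F" and x: "x \<in> open_segment a b" for a b x
  proof -
    obtain u where u: "0 < u" "u < 1" and xu: "x = (1 - u) *\<^sub>R a + u *\<^sub>R b"
      using x by (auto simp: in_segment)
    have "Poly_Mapping.lookup a p = Poly_Mapping.lookup a q
        \<and> Poly_Mapping.lookup b p = Poly_Mapping.lookup b q" if pq: "(p, q) \<in> E" for p q
    proof -
      define d e where "d = Poly_Mapping.lookup a q - Poly_Mapping.lookup a p"
        and "e = Poly_Mapping.lookup b q - Poly_Mapping.lookup b p"
      have nonneg: "0 \<le> d" "0 \<le> e"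
        using le[OF \<open>a \<in> S\<close> pq] le[OF \<open>b \<in> S\<close> pq] by (auto simp: d_def e_def)
      have "Poly_Mapping.lookup x p = Poly_Mapping.lookup x q"
        using \<open>x \<in> ?F\<close> pq by auto
      then have "(1 - u) * d + u * e = 0"
        unfolding xu d_def e_def lookup_add lookup_scaleR real_scaleR_def
        by (simp add: algebra_simps)
      moreover have "0 \<le> (1 - u) * d" "0 \<le> u * e"
        using nonneg u by auto
      ultimately have "(1 - u) * d = 0" "u * e = 0"
        by linarith+
      then show ?thesis
        using u by (auto simp: d_def e_def)
    qed
    then show ?thesis
      using that by auto
  qed
  ultimately show ?thesis
    unfolding face_of_def by blast
qed

section \<open>Convexity and monotonicity in Gelfand-Tsetlin polytopes\<close>

lemma convex_gt_polytope: "convex (gt_polytope lam)"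
  unfolding convex_def
proof (intro ballI allI impI)
  fix x y :: "(nat \<times> nat) \<Rightarrow>\<^sub>0 real" and u v :: real
  assume x: "x \<in> gt_polytope lam" and y: "y \<in> gt_polytope lam"
    and uv: "0 \<le> u" "0 \<le> v" "u + v = 1"
  let ?z = "u *\<^sub>R x + v *\<^sub>R y"
  have "Poly_Mapping.keys ?z \<subseteq> Poly_Mapping.keys x \<union> Poly_Mapping.keys y"
    by (auto simp: in_keys_iff lookup_add)
  \<comment> \<open>Both arrays share the top row, and a convex combination of equal entries gives
    that entry back.\<close>
  moreover have "u * r + v * r = r" for r
    using uv by (metis distrib_right mult_1)
  ultimately show "?z \<in> gt_polytope lam"
    using x y uv unfolding gt_polytope_def
    by (auto simp: lookup_add intro!: add_mono mult_left_mono add_nonneg_nonneg mult_nonneg_nonneg)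
qed

lemma gt_polytope_column_mono:
  assumes "x \<in> gt_polytope lam" and "1 \<le> j" and "j \<le> i" and "i \<le> k" and "k \<le> length lam"
  shows "Poly_Mapping.lookup x (i, j) \<le> Poly_Mapping.lookup x (k, j)"
  using \<open>i \<le> k\<close> \<open>k \<le> length lam\<close>
proof (induction k rule: dec_induct)
  case base
  then show ?case by simp
next
  case (step k)
  then have "Poly_Mapping.lookup x (k, j) \<le> Poly_Mapping.lookup x (k + 1, j)"
    using assms unfolding gt_polytope_def by simp
  with step show ?case by simp
qed

text \<open>Combined with monotonicity along columns, \<open>(l, l)\<close> \<le>
  \<open>(j, j)\<close> \<le> \<open>(i, j)\<close>, this makes the entry at \<open>(l, l)\<close> a
  minimum over the columns 1 to \<open>l\<close>.\<close>

lemma gt_polytope_diagonal_antimono: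
  assumes "x \<in> gt_polytope lam" and "1 \<le> j" and "j \<le> k" and "k \<le> length lam"
  shows "Poly_Mapping.lookup x (k, k) \<le> Poly_Mapping.lookup x (j, j)"
  using \<open>j \<le> k\<close> \<open>k \<le> length lam\<close>
proof (induction k rule: dec_induct)
  case base
  then show ?case by simp
next
  case (step k)
  then have "Poly_Mapping.lookup x (k + 1, k + 1) \<le> Poly_Mapping.lookup x (k, k)"
    using assms unfolding gt_polytope_def by simp
  with step show ?case by simp
qed

section \<open>The shape with \<open>l\<close> ones and \<open>l + 1\<close> zeros, and its
  face\<close>

definition rect_shape :: "nat \<Rightarrow> nat list" where
  "rect_shape l = replicate l 1 @ replicate (l + 1) 0"

definition upper_part :: "nat \<Rightarrow> (nat \<times> nat) set" where
  "upper_part l = {(i, j) \<in> gt_indices (2 * l + 1). 2 * j \<le> i}"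

definition zero_part :: "nat \<Rightarrow> (nat \<times> nat) set" where
  "zero_part l = {(i, j) \<in> gt_indices (2 * l + 1). j \<ge> l + 1}"

definition lower_part :: "nat \<Rightarrow> (nat \<times> nat) set" where
  "lower_part l = {(i, j) \<in> gt_indices (2 * l + 1). 2 * j \<ge> i + 2 \<and> j \<le> l}"

definition gt_face :: "nat \<Rightarrow> ((nat \<times> nat) \<Rightarrow>\<^sub>0 real) set" where
  "gt_face l = {x \<in> gt_polytope (rect_shape l).
     Poly_Mapping.lookup x constant_on upper_part l \<and>
     Poly_Mapping.lookup x constant_on zero_part l \<and>
     Poly_Mapping.lookup x constant_on lower_part l}"

lemma length_rect_shape [simp]: "length (rect_shape l) = 2 * l + 1"
  by (simp add: rect_shape_def)

lemma constant_on_iff: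
  assumes "a \<in> A"
  shows "f constant_on A \<longleftrightarrow> (\<forall>x\<in>A. f x = f a)"
  using assms unfolding constant_on_def by metis

lemma rect_top_row:
  assumes "x \<in> gt_polytope (rect_shape l)" and "1 \<le> j" and "j \<le> 2 * l + 1"
  shows "Poly_Mapping.lookup x (2 * l + 1, j) = (if j \<le> l then 1 else 0)"
proof -
  have "Poly_Mapping.lookup x (2 * l + 1, j) = real (rect_shape l ! (j - 1))"
    using assms unfolding gt_polytope_def by simp
  then show ?thesis
    using assms by (auto simp: rect_shape_def nth_append simp del: replicate_Suc)
qed

lemma rect_entry_le_1:
  assumes "x \<in> gt_polytope (rect_shape l)" and "(i, j) \<in> gt_indices (2 * l + 1)"
  shows "Poly_Mapping.lookup x (i, j) \<le> 1"
  using assms gt_polytope_column_mono[of x "rect_shape l" j i "2 * l + 1"] rect_top_row[of x l j]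
  by (auto simp: gt_indices_def split: if_splits)

text \<open>The entries are squeezed between 0 and the top row entry of their column, which is 0
  from column \<open>l + 1\<close> on.\<close>

lemma rect_entry_zero:
  assumes "x \<in> gt_polytope (rect_shape l)" and "(i, j) \<in> zero_part l"
  shows "Poly_Mapping.lookup x (i, j) = 0"
proof -
  have "0 \<le> Poly_Mapping.lookup x (i, j)"
    using assms(1) by (auto simp: gt_polytope_def)
  then show ?thesis
    using assms gt_polytope_column_mono[of x "rect_shape l" j i "2 * l + 1"] rect_top_row[of x l j]
    by (auto simp: gt_indices_def zero_part_def split: if_splits)
qed

text \<open>Constancy becomes equality with a representative: \<open>(2 * l + 1, 1)\<close> in the
  top row, with value 1, for \<open>upper_part\<close>, and the minimal entry \<open>(l, l)\<close>
  for \<open>lower_part\<close>. The latter position lies in \<open>lower_part\<close> because 2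
  \<le> \<open>l\<close> gives \<open>2 * l\<close> \<ge> \<open>l + 2\<close>.\<close>

lemma gt_face_alt:
  assumes "2 \<le> l"
  shows "gt_face l = {x \<in> gt_polytope (rect_shape l).
    (\<forall>p \<in> upper_part l. Poly_Mapping.lookup x p = 1) \<and>
    (\<forall>p \<in> lower_part l. Poly_Mapping.lookup x p = Poly_Mapping.lookup x (l, l))}"
proof -
  have "(2 * l + 1, 1) \<in> upper_part l" "(l, l) \<in> lower_part l"
    using assms by (auto simp: upper_part_def lower_part_def gt_indices_def)
  moreover have "Poly_Mapping.lookup x (2 * l + 1, 1) = 1" "Poly_Mapping.lookup x constant_on zero_part l"
    if "x \<in> gt_polytope (rect_shape l)" for x
    using that assms rect_top_row[of x l 1] rect_entry_zero[of x l]
    by (auto simp: constant_on_def)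
  ultimately show ?thesis
    unfolding gt_face_def
    by (auto simp: constant_on_iff[of "(2 * l + 1, 1)" "upper_part l"]
        constant_on_iff[of "(l, l)" "lower_part l"])
qed

lemma gt_face_face_of:
  assumes "2 \<le> l"
  shows "gt_face l face_of gt_polytope (rect_shape l)"
proof -
  \<comment> \<open>Each pair is an inequality valid on the whole polytope: entries of
    \<open>upper_part\<close> are at most the top row entry 1, and those of
    \<open>lower_part\<close> are at least the entry at \<open>(l, l)\<close>. Turning all of them
    into equalities cuts out the face.\<close>
  define E where "E = upper_part l \<times> {(2 * l + 1, 1)} \<union> {(l, l)} \<times> lower_part l"
  have top: "Poly_Mapping.lookup x (2 * l + 1, 1) = 1"
    if "x \<in> gt_polytope (rect_shape l)" for x
    using that assms rect_top_row[of x l 1] by simp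
  have "Poly_Mapping.lookup x p \<le> Poly_Mapping.lookup x q"
    if x: "x \<in> gt_polytope (rect_shape l)" and "(p, q) \<in> E" for x p q
    using \<open>(p, q) \<in> E\<close> unfolding E_def
  proof (elim UnE SigmaE2)
    assume "p \<in> upper_part l" "q \<in> {(2 * l + 1, 1)}"
    then show ?thesis
      using top[OF x] rect_entry_le_1[OF x] by (auto simp: upper_part_def)
  next
    assume p: "p \<in> {(l, l)}" and q: "q \<in> lower_part l"
    then obtain i j where ij: "q = (i, j)" "1 \<le> j" "j \<le> i" "i \<le> 2 * l + 1" "j \<le> l"
      by (auto simp: lower_part_def gt_indices_def)
    have "Poly_Mapping.lookup x (l, l) \<le> Poly_Mapping.lookup x (j, j)"
      using gt_polytope_diagonal_antimono[OF x] ij by simp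
    also have "\<dots> \<le> Poly_Mapping.lookup x (i, j)"
      using gt_polytope_column_mono[OF x] ij by simp
    finally show ?thesis
      using p ij by simp
  qed
  then have "{x \<in> gt_polytope (rect_shape l).
      \<forall>(p, q) \<in> E. Poly_Mapping.lookup x p = Poly_Mapping.lookup x q} face_of gt_polytope (rect_shape l)"
    by (intro face_of_lookup_equalities convex_gt_polytope)
  moreover have "{x \<in> gt_polytope (rect_shape l).
      \<forall>(p, q) \<in> E. Poly_Mapping.lookup x p = Poly_Mapping.lookup x q} = gt_face l"
    unfolding gt_face_alt[OF assms]
  proof (intro Collect_cong conj_cong refl)
    fix x
    assume "x \<in> gt_polytope (rect_shape l)"
    then show "(\<forall>(p, q) \<in> E. Poly_Mapping.lookup x p = Poly_Mapping.lookup x q) \<longleftrightarrow>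
      (\<forall>p \<in> upper_part l. Poly_Mapping.lookup x p = 1) \<and>
      (\<forall>p \<in> lower_part l. Poly_Mapping.lookup x p = Poly_Mapping.lookup x (l, l))"
      using top[of x] unfolding E_def by (force simp: ball_Un)
  qed
  ultimately show ?thesis
    by simp
qed

section \<open>Parametrization of the face by \<open>t\<close> and \<open>y\<close>\<close>

text \<open>
  The parameter \<open>c\<close> is the top value: 1 on the face itself, \<open>n\<close> on its \<open>n\<close>-th dilate.
\<close>

definition face_entry :: "nat \<Rightarrow> real \<Rightarrow> real \<Rightarrow> (nat \<Rightarrow> real) \<Rightarrow> nat \<times> nat \<Rightarrow> real" where
  "face_entry l c t y = (\<lambda>(i, j).
     if (i, j) \<notin> gt_indices (2 * l + 1) then 0
     else if 2 * j \<le> i then c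
     else if l + 1 \<le> j then 0
     else if i + 1 = 2 * j then y j
     else t)"

definition face_point :: "nat \<Rightarrow> real \<Rightarrow> real \<Rightarrow> (nat \<Rightarrow> real) \<Rightarrow> (nat \<times> nat) \<Rightarrow>\<^sub>0 real" where
  "face_point l c t y = Abs_poly_mapping (face_entry l c t y)"

lemma finite_gt_indices: "finite (gt_indices m)"
  by (rule finite_subset[of _ "{..m} \<times> {..m}"]) (auto simp: gt_indices_def)

lemma lookup_face_point [simp]: "Poly_Mapping.lookup (face_point l c t y) = face_entry l c t y"
proof -
  have "{p. face_entry l c t y p \<noteq> 0} \<subseteq> gt_indices (2 * l + 1)"
    by (auto simp: face_entry_def split: if_splits)
  then show ?thesis
    unfolding face_point_def
    by (intro lookup_Abs_poly_mapping finite_subset[OF _ finite_gt_indices])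
qed

lemma scaleR_face_point:
  "r *\<^sub>R face_point l c t y = face_point l (r * c) (r * t) (\<lambda>j. r * y j)"
  by (rule poly_mapping_eqI) (auto simp: face_entry_def)

text \<open>The entry at \<open>(2 * j - 1, j)\<close> is compared only with
  \<open>(2 * j, j)\<close> and \<open>(2 * j - 2, j - 1)\<close>, which carry 1, and with
  \<open>(2 * j - 2, j)\<close> and \<open>(2 * j, j + 1)\<close>, which carry \<open>t\<close> or
  0. No inequality links two of the \<open>y j\<close>, so they vary independently.\<close>

lemma face_point_in_gt_face:
  assumes "2 \<le> l" and "0 \<le> t" and y: "\<And>j. j \<in> {1..l} \<Longrightarrow> t \<le> y j \<and> y j \<le> 1"
  shows "face_point l 1 t y \<in> gt_face l"
proof -
  \<comment> \<open>The upper bound on \<open>t\<close> passes through \<open>y 1\<close>.\<close>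
  have "t \<le> 1"
    using y[of 1] \<open>2 \<le> l\<close> by simp
  have "face_point l 1 t y \<in> gt_polytope (rect_shape l)"
    unfolding gt_polytope_def
  proof (intro CollectI conjI allI ballI impI; (elim conjE)?)
    show "Poly_Mapping.keys (face_point l 1 t y) \<subseteq> gt_indices (length (rect_shape l))"
      by (auto simp: in_keys_iff face_entry_def split: if_splits)
    show "0 \<le> Poly_Mapping.lookup (face_point l 1 t y) (i, j)" for i j
      using y[of j] \<open>0 \<le> t\<close> by (auto simp: face_entry_def gt_indices_def)
    show "Poly_Mapping.lookup (face_point l 1 t y) (length (rect_shape l), j)
        = real (rect_shape l ! (j - 1))" if "j \<in> {1..length (rect_shape l)}" for j
      using that
      by (auto simp: face_entry_def gt_indices_def rect_shape_def nth_append simp del: replicate_Suc)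
    show "Poly_Mapping.lookup (face_point l 1 t y) (i, j)
        \<le> Poly_Mapping.lookup (face_point l 1 t y) (i + 1, j)"
      if "1 \<le> j" "j \<le> i" "i + 1 \<le> length (rect_shape l)" for i j
      using that y[of j] \<open>0 \<le> t\<close> \<open>t \<le> 1\<close> by (auto simp: face_entry_def gt_indices_def)
    show "Poly_Mapping.lookup (face_point l 1 t y) (i + 1, j + 1)
        \<le> Poly_Mapping.lookup (face_point l 1 t y) (i, j)"
      if "1 \<le> j" "j \<le> i" "i + 1 \<le> length (rect_shape l)" for i j
      using that y[of j] y[of "j + 1"] \<open>0 \<le> t\<close> \<open>t \<le> 1\<close>
      by (auto simp: face_entry_def gt_indices_def)
  qed
  then show ?thesis
    using \<open>2 \<le> l\<close> unfolding gt_face_alt[OF \<open>2 \<le> l\<close>]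
    by (auto simp: face_entry_def upper_part_def lower_part_def gt_indices_def)
qed

lemma gt_face_eq:
  assumes "2 \<le> l"
  shows "gt_face l =
    {face_point l 1 t y |t y. 0 \<le> t \<and> (\<forall>j\<in>{1..l}. t \<le> y j \<and> y j \<le> 1)}" (is "_ = ?R")
proof (intro equalityI subsetI)
  fix x
  assume "x \<in> gt_face l"
  then have x: "x \<in> gt_polytope (rect_shape l)"
    and upper: "\<And>i j. (i, j) \<in> upper_part l \<Longrightarrow> Poly_Mapping.lookup x (i, j) = 1"
    and lower: "\<And>i j. (i, j) \<in> lower_part l \<Longrightarrow> Poly_Mapping.lookup x (i, j) = Poly_Mapping.lookup x (l, l)"
    by (auto simp: gt_face_alt[OF assms])
  define t where "t = Poly_Mapping.lookup x (l, l)"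
  define y where "y j = Poly_Mapping.lookup x (2 * j - 1, j)" for j
  have "0 \<le> t"
    using x by (simp add: t_def gt_polytope_def)
  moreover have "t \<le> y j \<and> y j \<le> 1" if j: "j \<in> {1..l}" for j
  proof
    show "y j \<le> 1"
      unfolding y_def using j by (intro rect_entry_le_1[OF x]) (auto simp: gt_indices_def)
    have "t \<le> Poly_Mapping.lookup x (j, j)"
      unfolding t_def using j by (intro gt_polytope_diagonal_antimono[OF x]) auto
    also have "\<dots> \<le> y j"
      unfolding y_def using j by (intro gt_polytope_column_mono[OF x]) auto
    finally show "t \<le> y j" .
  qed
  moreover have "x = face_point l 1 t y"
  proof (rule poly_mapping_eqI)
    fix p :: "nat \<times> nat"
    obtain i j where p: "p = (i, j)"
      by fastforce
    \<comment> \<open>The corner \<open>(2 * l + 1, l + 1)\<close> also satisfies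
      \<open>i + 1 = 2 * j\<close>. The bound \<open>j \<le> l\<close> leaves it to
      \<open>zero_part\<close>, in agreement with the order of the tests in
      \<open>face_entry\<close>.\<close>
    consider "(i, j) \<notin> gt_indices (2 * l + 1)" | "(i, j) \<in> upper_part l" | "(i, j) \<in> zero_part l"
      | "(i, j) \<in> lower_part l" | "(i, j) \<in> gt_indices (2 * l + 1)" "i + 1 = 2 * j" "j \<le> l"
      by (force simp: upper_part_def zero_part_def lower_part_def)
    then have "Poly_Mapping.lookup x (i, j) = face_entry l 1 t y (i, j)"
    proof cases
      case 1
      then have "Poly_Mapping.lookup x (i, j) = 0"
        using x by (auto simp: gt_polytope_def in_keys_iff)
      with 1 show ?thesis by (simp add: face_entry_def)
    next
      case 2
      then show ?thesis using upper[OF 2] by (auto simp: face_entry_def upper_part_def)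
    next
      case 3
      then show ?thesis
        using rect_entry_zero[OF x 3] by (auto simp: face_entry_def zero_part_def gt_indices_def)
    next
      case 4
      then show ?thesis
        using lower[OF 4] by (auto simp: face_entry_def lower_part_def t_def)
    next
      case 5
      then have "i = 2 * j - 1" by simp
      with 5 show ?thesis by (auto simp: face_entry_def y_def)
    qed
    then show "Poly_Mapping.lookup x p = Poly_Mapping.lookup (face_point l 1 t y) p"
      by (simp add: p)
  qed
  ultimately show "x \<in> ?R"
    by blast
next
  fix x
  assume "x \<in> ?R"
  then show "x \<in> gt_face l"
    using face_point_in_gt_face[OF assms] by blast
qed

text \<open>The parameters can be read off the array: \<open>t\<close> at \<open>(l, l)\<close> and
  \<open>y j\<close> at \<open>(2 * j - 1, j)\<close>.\<close>

lemma face_point_eq_iff: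
  assumes "2 \<le> l"
  shows "face_point l c t y = face_point l c t' y' \<longleftrightarrow> t = t' \<and> (\<forall>j\<in>{1..l}. y j = y' j)"
proof
  assume "face_point l c t y = face_point l c t' y'"
  then have eq: "face_entry l c t y p = face_entry l c t' y' p" for p
    by (metis lookup_face_point)
  have "t = t'"
    using eq[of "(l, l)"] assms by (auto simp: face_entry_def gt_indices_def)
  moreover have "y j = y' j" if "j \<in> {1..l}" for j
    using eq[of "(2 * j - 1, j)"] that
    by (auto simp: face_entry_def gt_indices_def split: if_splits)
  ultimately show "t = t' \<and> (\<forall>j\<in>{1..l}. y j = y' j)"
    by blast
next
  assume "t = t' \<and> (\<forall>j\<in>{1..l}. y j = y' j)"
  then show "face_point l c t y = face_point l c t' y'"
    by (intro poly_mapping_eqI) (auto simp: face_entry_def gt_indices_def)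
qed

section \<open>Integer points of the dilates\<close>

text \<open>Every entry of a dilated point is 0, \<open>n\<close> or a scaled parameter, so the
  point is integral exactly when the scaled parameters are. The extensional function space fixes
  \<open>y\<close> outside \<open>{1..l}\<close>, giving each point a single pair of
  parameters.\<close>

lemma scaled_gt_face_integer_points:
  assumes "2 \<le> l" and "0 < n"
  shows "(\<lambda>x. real n *\<^sub>R x) ` gt_face l \<inter> integer_points =
    (\<lambda>(t, y). face_point l (real n) (real t) (\<lambda>j. real (y j))) `
      (SIGMA t:{0..n}. {1..l} \<rightarrow>\<^sub>E {t..n})" (is "?L = ?R")
proof (intro equalityI subsetI)
  fix z
  assume "z \<in> ?L"
  then obtain t y where int: "z \<in> integer_points" and t: "0 \<le> t"
    and y: "\<And>j. j \<in> {1..l} \<Longrightarrow> t \<le> y j \<and> y j \<le> 1"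
    and z: "z = face_point l (real n) (real n * t) (\<lambda>j. real n * y j)"
    unfolding gt_face_eq[OF \<open>2 \<le> l\<close>] by (auto simp: scaleR_face_point)
  have "Poly_Mapping.lookup z p \<in> \<int>" for p
    using int unfolding integer_points_def by blast
  from this[of "(l, l)"] have "real n * t \<in> \<int>"
    using \<open>2 \<le> l\<close> by (auto simp: z face_entry_def gt_indices_def)
  moreover have y_Ints: "real n * y j \<in> \<int>" if "j \<in> {1..l}" for j
    using \<open>Poly_Mapping.lookup z (2 * j - 1, j) \<in> \<int>\<close> that
    by (auto simp: z face_entry_def gt_indices_def split: if_splits)
  ultimately obtain t' where t': "real n * t = real t'"
    using t by (metis Ints_cases mult_nonneg_nonneg nonneg_int_cases of_int_0_le_iff of_int_of_nat_eq of_nat_0_le_iff)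
  have "\<exists>k::nat. real n * y j = real k" if "j \<in> {1..l}" for j
    using y_Ints[OF that] y[OF that] t
    by (metis Ints_cases mult_nonneg_nonneg nonneg_int_cases of_int_0_le_iff of_int_of_nat_eq of_nat_0_le_iff order_trans)
  then obtain y' where y': "\<And>j. j \<in> {1..l} \<Longrightarrow> real n * y j = real (y' j)"
    by metis
  have bounds: "t' \<le> y' j \<and> y' j \<le> n" if "j \<in> {1..l}" for j
  proof -
    have "real t' \<le> real (y' j)" "real (y' j) \<le> real n"
      using y[OF that] \<open>0 < n\<close> unfolding y'[OF that, symmetric] t'[symmetric] by auto
    then show ?thesis by simp
  qed
  have "t' \<le> n"
    using bounds[of 1] \<open>2 \<le> l\<close> by force
  then have "(t', restrict y' {1..l}) \<in> (SIGMA t:{0..n}. {1..l} \<rightarrow>\<^sub>E {t..n})"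
    using bounds by auto
  moreover have "z = face_point l (real n) (real t') (\<lambda>j. real (restrict y' {1..l} j))"
    using y' by (simp add: z t' face_point_eq_iff[OF \<open>2 \<le> l\<close>])
  \<comment> \<open>Restricting \<open>y'\<close> puts it into the extensional function space and
    leaves the array unchanged.\<close>
  ultimately show "z \<in> ?R"
    by (intro image_eqI[of _ _ "(t', restrict y' {1..l})"]) auto
next
  fix z
  assume "z \<in> ?R"
  then obtain t y where z: "z = face_point l (real n) (real t) (\<lambda>j. real (y j))"
    and "t \<le> n" and y: "y \<in> {1..l} \<rightarrow>\<^sub>E {t..n}"
    by auto
  \<comment> \<open>Dividing all parameters by \<open>n\<close> yields the preimage under the
    dilation.\<close>
  have "z = real n *\<^sub>R face_point l 1 (real t / real n) (\<lambda>j. real (y j) / real n)"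
    using \<open>0 < n\<close> by (simp add: z scaleR_face_point)
  moreover have "real t / real n \<le> real (y j) / real n \<and> real (y j) / real n \<le> 1" if "j \<in> {1..l}" for j
    using PiE_mem[OF y that] \<open>0 < n\<close> by (auto simp: field_simps)
  ultimately have "z \<in> (\<lambda>x. real n *\<^sub>R x) ` gt_face l"
    using face_point_in_gt_face[OF \<open>2 \<le> l\<close>] by (auto simp del: One_nat_def)
  moreover have "z \<in> integer_points"
    by (auto simp: z integer_points_def face_entry_def)
  ultimately show "z \<in> ?L"
    by blast
qed

lemma card_scaled_gt_face:
  assumes "2 \<le> l" and "0 < n"
  shows "card ((\<lambda>x. real n *\<^sub>R x) ` gt_face l \<inter> integer_points) = (\<Sum>k\<le>n. (k + 1) ^ l)"
proof -
  let ?S = "SIGMA t:{0..n}. {1..l} \<rightarrow>\<^sub>E {t..n}"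
  have "inj_on (\<lambda>(t, y). face_point l (real n) (real t) (\<lambda>j. real (y j))) ?S"
    by (auto simp: inj_on_def face_point_eq_iff[OF \<open>2 \<le> l\<close>] simp del: One_nat_def intro: PiE_ext)
  then have "card ((\<lambda>x. real n *\<^sub>R x) ` gt_face l \<inter> integer_points) = card ?S"
    unfolding scaled_gt_face_integer_points[OF assms] by (rule card_image)
  \<comment> \<open>For fixed \<open>t\<close>, each of the \<open>l\<close> coordinates ranges over
    the \<open>n - t + 1\<close> integers from \<open>t\<close> to \<open>n\<close>.\<close>
  also have "\<dots> = (\<Sum>t=0..n. (n - t + 1) ^ l)"
    by (subst card_SigmaI) (auto intro!: finite_PiE sum.cong simp: card_PiE Suc_diff_le)
  also have "\<dots> = (\<Sum>k\<le>n. (k + 1) ^ l)"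
    by (rule sum.reindex_bij_witness[of _ "\<lambda>k. n - k" "\<lambda>k. n - k"]) auto
  finally show ?thesis .
qed

section \<open>The power sum of exponent 20 and its negative coefficient\<close>

text \<open>
  Faulhaber's polynomial for $\<Sum>_{k \<le> N} k^{20}$, expanded at $N = n + 1$.
\<close>

definition power_sum_20 :: "real poly" where
  "power_sum_20 = smult (1 / 6930)
    [:6930, -3528231, 1316700, 32027050, 33575850, 59817681, 268606800, 581981400, 872972100,
      1139411570, 1280359080, 1172780700, 872972100, 534975210, 268606800, 107869080, 33575850,
      7834365, 1316700, 150150, 10395, 330:]"

text \<open>This is the induction step: the sum for \<open>n\<close> ends with
  \<open>(n + 1) ^ 20\<close>, so passing to \<open>n + 1\<close> adds \<open>(n + 2) ^ 20\<close>.
  Stated between polynomials, through composition with \<open>[:1, 1:]\<close>, it is a comparison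
  of finitely many coefficients.\<close>

lemma poly_power_sum_20_step: "poly power_sum_20 (x + 1) = poly power_sum_20 x + (x + 2) ^ 20"
proof -
  have "pcompose power_sum_20 [:1, 1:] = power_sum_20 + [:2, 1:] ^ 20"
    by (simp add: power_sum_20_def pcompose_pCons eval_nat_numeral)
  then have "poly (pcompose power_sum_20 [:1, 1:]) x = poly (power_sum_20 + [:2, 1:] ^ 20) x"
    by simp
  then show ?thesis
    by (simp add: poly_pcompose add_ac)
qed

lemma poly_power_sum_20: "poly power_sum_20 (real n) = (\<Sum>k\<le>n. (real k + 1) ^ 20)"
proof (induction n)
  case 0
  \<comment> \<open>The constant coefficient is 6930 / 6930 = 1, the single term of the sum.\<close>
  show ?case by (simp add: power_sum_20_def)
next
  case (Suc n)
  then show ?case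
    using poly_power_sum_20_step[of "real n"] by (simp add: add_ac)
qed

theorem mainTheorem2:
  fixes l m :: nat
    and lam :: "nat list"
    and F :: "((nat \<times> nat) \<Rightarrow>\<^sub>0 real) set"
  assumes "l = 20"
    and "m = 2 * l + 1"
    and "lam = replicate l 1 @ replicate (l + 1) 0"
    and "F = {x \<in> gt_polytope lam.
           Poly_Mapping.lookup x constant_on {(i, j) \<in> gt_indices m. 2 * j \<le> i} \<and>
           Poly_Mapping.lookup x constant_on {(i, j) \<in> gt_indices m. j \<ge> l + 1} \<and>
           Poly_Mapping.lookup x constant_on {(i, j) \<in> gt_indices m. 2 * j \<ge> i + 2 \<and> j \<le> l}}"
  shows "F face_of gt_polytope lam \<and>
    (\<exists>p. is_ehrhart_polynomial F p \<and> (\<exists>k. coeff p k < 0))"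
proof -
  have lam: "lam = rect_shape l"
    by (simp only: assms(3) rect_shape_def)
  have F: "F = gt_face l"
    unfolding assms(4) gt_face_def lam upper_part_def zero_part_def lower_part_def assms(2) ..
  have l: "2 \<le> l"
    using assms(1) by simp
  have "is_ehrhart_polynomial F power_sum_20"
    unfolding is_ehrhart_polynomial_def F
    using card_scaled_gt_face[OF l] by (simp add: poly_power_sum_20 assms(1) add_ac)
  \<comment> \<open>Splitting the sum up to \<open>n + 1\<close> into the sum up to \<open>n\<close>
    and \<open>(n + 1) ^ 20\<close>, the linear coefficients are the Bernoulli number -174611 / 330
    and 20. Together they give -3528231 / 6930, about -509.\<close>
  moreover have "coeff power_sum_20 1 < 0"
    by (simp add: power_sum_20_def)
  ultimately show ?thesis
    using gt_face_face_of[OF l] F lam by blast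
qed

end
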